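(* Let $m_n:=\lfloor n/2\rfloor$. Let $\{\lambda^{(n)}\vdash n\}$ and $\{\mu^{(n)}\vdash m_n\}$ be two partition sequences which satisfy $$f^{\lambda^{(n)}/\mu^{(n)}}\,=\,\sqrt{\frac{n!}{m_n!}}\;e^{O(n/\log n)}.$$ Then $$f^{\lambda^{(n)}}=\sqrt{n!}\;e^{O(n)}\qquad\text{and}\qquad f^{\mu^{(n)}}=\sqrt{m_n!}\;e^{O(n)}.$$
   Context: $f^{\lambda/\mu}$ denotes the number of standard Young tableaux of skew shape $\lambda/\mu$ (zero if $\mu\not\subseteq\lambda$), and $f^\lambda=f^{\lambda/\varnothing}$. The notation $X(n)=Y(n)\,e^{O(h(n))}$ means that there is a constant $C>0$ with $Y(n)e^{-Ch(n)}\le X(n)\le Y(n)e^{Ch(n)}$ for all sufficiently large $n$. *)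

theory Defs
  imports Complex_Main "HOL-Library.FuncSet"
begin

definition partition_of :: "nat list \<Rightarrow> nat \<Rightarrow> bool" (infix "\<turnstile>" 50)
  where "lam \<turnstile> n \<longleftrightarrow> sorted_wrt (\<ge>) lam \<and> 0 \<notin> set lam \<and> sum_list lam = n"

text \<open>Cells are pairs (row, column), both counted from 0.\<close>

definition young_diagram :: "nat list \<Rightarrow> (nat \<times> nat) set"
  where "young_diagram lam = {(i, j). i < length lam \<and> j < lam ! i}"

text \<open>
  Fillings of a finite set of cells with \<open>1, \<dots>, card D\<close>, each used once, that increase along
  rows and down columns. Fillings are \<^term>\<open>undefined\<close> outside \<open>D\<close>, so that each tableau is
  represented by exactly one function.
\<close>

definition standard_tableaux :: "(nat \<times> nat) set \<Rightarrow> (nat \<times> nat \<Rightarrow> nat) set"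
  where "standard_tableaux D =
    {T \<in> extensional D.
       bij_betw T D {1..card D} \<and>
       (\<forall>i j j'. (i, j) \<in> D \<and> (i, j') \<in> D \<and> j < j' \<longrightarrow> T (i, j) < T (i, j')) \<and>
       (\<forall>i i' j. (i, j) \<in> D \<and> (i', j) \<in> D \<and> i < i' \<longrightarrow> T (i, j) < T (i', j))}"

definition num_skew_syt :: "nat list \<Rightarrow> nat list \<Rightarrow> nat"
  where "num_skew_syt lam mu =
    (if young_diagram mu \<subseteq> young_diagram lam
     then card (standard_tableaux (young_diagram lam - young_diagram mu)) else 0)"

definition num_syt :: "nat list \<Rightarrow> nat"
  where "num_syt lam = num_skew_syt lam []"

text \<open>The relation \<open>X(n) = Y(n) e\<^bsup>O(h(n))\<^esup>\<close>.\<close>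

definition eq_up_to_exp_O ::
  "(nat \<Rightarrow> real) \<Rightarrow> (nat \<Rightarrow> real) \<Rightarrow> (nat \<Rightarrow> real) \<Rightarrow> bool"
  where "eq_up_to_exp_O X Y h \<longleftrightarrow>
    (\<exists>C>0. \<forall>\<^sub>F n in sequentially.
       Y n * exp (- C * h n) \<le> X n \<and> X n \<le> Y n * exp (C * h n))"

end

theory Submission
  imports Defs "HOL-Analysis.Convex"
begin

text \<open>
  Why the theorem holds. Write \<open>k = n div 2\<close> and let \<open>U\<close>, \<open>D\<close> be the operators of Young's
  lattice that add and remove a cell; they are adjoint, and \<open>D U - U D = 1\<close>. Removing the cells
  of \<open>\<lambda>\<close> one at a time shows that the coefficients of \<open>D\<^bsup>n-l\<^esup> \<lambda>\<close> are the numbers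
  \<open>f\<^bsup>\<lambda>/\<nu>\<^esup>\<close> with \<open>|\<nu>| = l\<close>. Its squared norm \<open>Q l\<close> (\<open>sum_squares\<close>) starts at \<open>Q n = 1\<close> and ends at
  \<open>Q 0 = (f\<^bsup>\<lambda>\<^esup>)\<^sup>2\<close>.

  The steps \<open>Q (l - 1) / Q l\<close> are compared with \<open>l\<close>. If they were all equal to \<open>l\<close>, then \<open>Q 0\<close> would be
  \<open>n!\<close>. Call \<open>l - Q (l - 1) / Q l\<close> the defect. The commutation relation and the Cauchy--Schwarz
  inequality for \<open>\<langle>U D v, v\<rangle> = \<parallel>D v\<parallel>\<^sup>2\<close>, applied to \<open>v = D\<^bsup>n-l\<^esup> \<lambda>\<close>, give
  (\<open>sum_squares_ratio\<close>) that the defect can only shrink as \<open>l\<close> decreases.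

  The hypothesis says that \<open>Q k \<ge> (n!/k!) e\<^bsup>-L\<^esup>\<close> with \<open>L = O(n / log n)\<close>. Every defect on the
  levels above \<open>k\<close> is at least the one at \<open>k\<close>, and if that one is positive, it makes each of these
  at least \<open>n/2\<close> steps smaller than \<open>l\<close> by a factor \<open>1 - defect / n\<close> or less. So the
  defect at \<open>k\<close>, and hence on all lower levels, is at most \<open>2 L\<close>
  (\<open>ratio_defect_descent\<close>). Down to the level \<open>m\<close> of order \<open>4 L\<close> each step is therefore at
  least \<open>l/2\<close>, whence \<open>Q m \<ge> (n!/m!) e\<^bsup>-O(n)\<^esup>\<close>. The scale \<open>n / log n\<close> is what makes
  \<open>m! \<le> n\<^sup>m = e\<^bsup>O(n)\<^esup>\<close>. Finally \<open>f\<^bsup>\<lambda>\<^esup> \<ge> \<Sum>\<^sub>\<nu> f\<^bsup>\<lambda>/\<nu>\<^esup>\<close> over all \<open>\<nu>\<close> of size \<open>m\<close>,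
  because each tableau of shape \<open>\<lambda>/\<nu>\<close> extends to one of shape \<open>\<lambda>\<close>, and so \<open>(f\<^bsup>\<lambda>\<^esup>)\<^sup>2 \<ge> Q m\<close>.

  Everything else follows from \<open>f\<^bsup>\<lambda>\<^esup> f\<^bsup>\<lambda>/\<mu>\<^esup> \<le> (n!/|\<mu>|!) f\<^bsup>\<mu>\<^esup>\<close>
  (\<open>syt_count_mult_skew_count_le\<close>). For the given \<open>\<mu>\<close> it turns the lower bound for \<open>f\<^bsup>\<lambda>\<^esup>\<close> into the one
  for \<open>f\<^bsup>\<mu>\<^esup>\<close>, and for empty \<open>\<mu>\<close> it is the upper bound \<open>f\<^bsup>\<lambda>\<^esup> \<le> \<surd>n!\<close>.
\<close>

section \<open>Young diagrams as order ideals\<close>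

definition order_ideal :: "(nat \<times> nat) set \<Rightarrow> bool"
  where "order_ideal S \<longleftrightarrow> (\<forall>i j i' j'. (i, j) \<in> S \<and> i' \<le> i \<and> j' \<le> j \<longrightarrow> (i', j') \<in> S)"

definition shapes :: "nat \<Rightarrow> (nat \<times> nat) set set"
  where "shapes n = {S. finite S \<and> order_ideal S \<and> card S = n}"

lemma order_idealD: "order_ideal S \<Longrightarrow> (i, j) \<in> S \<Longrightarrow> i' \<le> i \<Longrightarrow> j' \<le> j \<Longrightarrow> (i', j') \<in> S"
  unfolding order_ideal_def by blast

lemma shapesD:
  assumes "S \<in> shapes n"
  shows "finite S" "order_ideal S" "card S = n"
  using assms by (auto simp: shapes_def)

text \<open>
  An order ideal that contains \<open>(i, j)\<close> contains the \<open>i + 1\<close> cells above it (with itself) and the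
  \<open>j + 1\<close> cells to its left, so both coordinates stay below the size. This makes each level of
  Young's lattice finite.
\<close>

lemma shapes_subset_Pow: "shapes n \<subseteq> Pow ({..<n} \<times> {..<n})"
proof (clarsimp simp: shapes_def, intro conjI)
  fix S i j assume S: "finite S" "order_ideal S" "(i, j) \<in> S"
  have "(\<lambda>k. (k, j)) ` {..i} \<subseteq> S" "(\<lambda>k. (i, k)) ` {..j} \<subseteq> S"
    using S(2,3) by (auto dest: order_idealD)
  then have "card ((\<lambda>k. (k, j)) ` {..i}) \<le> card S" "card ((\<lambda>k. (i, k)) ` {..j}) \<le> card S"
    using S(1) by (auto intro: card_mono)
  moreover have "card ((\<lambda>k. (k, j)) ` {..i}) = Suc i" "card ((\<lambda>k. (i, k)) ` {..j}) = Suc j"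
    by (auto simp: card_image inj_on_def)
  ultimately show "i < card S" "j < card S" by auto
qed

lemma finite_shapes [simp]: "finite (shapes n)"
  by (rule finite_subset[OF shapes_subset_Pow]) auto

lemma shapes_0 [simp]: "shapes 0 = {{}}"
  by (auto simp: shapes_def order_ideal_def)

lemma young_diagram_in_shapes:
  assumes "lam \<turnstile> n"
  shows "young_diagram lam \<in> shapes n"
proof -
  have eq: "young_diagram lam = (SIGMA i:{..<length lam}. {..<lam ! i})"
    by (auto simp: young_diagram_def)
  have mono: "lam ! i \<le> lam ! i'" if "i' \<le> i" "i < length lam" for i i'
    using assms that sorted_wrt_nth_less[of "(\<ge>)" lam i' i]
    by (cases "i' = i") (auto simp: partition_of_def)
  have "order_ideal (young_diagram lam)"
    unfolding order_ideal_def young_diagram_def using mono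
    by auto (meson le_less_trans less_le_trans)
  moreover have "card (young_diagram lam) = n"
    unfolding eq using assms
    by (simp add: partition_of_def sum_list_sum_nth atLeast0LessThan)
  ultimately show ?thesis
    by (simp add: shapes_def eq)
qed

lemma shapes_same_size_subset:
  assumes "S \<in> shapes n" "T \<in> shapes n" "S \<subseteq> T"
  shows "S = T"
  using assms card_subset_eq[of T S] by (auto simp: shapes_def)

lemma shapes_Suc_obtain_cell:
  assumes "S \<in> shapes n" "T \<in> shapes (Suc n)" "S \<subseteq> T"
  obtains x where "x \<notin> S" "T = insert x S"
proof -
  have "card (T - S) = 1"
    using assms by (simp add: shapes_def card_Diff_subset)
  then obtain x where "T - S = {x}" by (auto simp: card_1_singleton_iff)
  then show ?thesis using that[of x] assms(3) by blast
qed

section \<open>Adding and removing cells\<close>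

definition addable :: "(nat \<times> nat) set \<Rightarrow> (nat \<times> nat) set"
  where "addable S = {x. x \<notin> S \<and> order_ideal (insert x S)}"

definition removable :: "(nat \<times> nat) set \<Rightarrow> (nat \<times> nat) set"
  where "removable S = {x \<in> S. order_ideal (S - {x})}"

lemma card_up_covers:
  assumes "S \<in> shapes n"
  shows "card {T \<in> shapes (Suc n). S \<subseteq> T} = card (addable S)"
proof -
  have "{T \<in> shapes (Suc n). S \<subseteq> T} = (\<lambda>x. insert x S) ` addable S"
  proof (intro equalityI subsetI)
    fix T assume "T \<in> {T \<in> shapes (Suc n). S \<subseteq> T}"
    then have T: "T \<in> shapes (Suc n)" "S \<subseteq> T" by auto
    then obtain x where "x \<notin> S" "T = insert x S" using shapes_Suc_obtain_cell assms by blast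
    then show "T \<in> (\<lambda>x. insert x S) ` addable S"
      using T by (auto simp: addable_def shapes_def)
  qed (use assms in \<open>auto simp: addable_def shapes_def\<close>)
  moreover have "inj_on (\<lambda>x. insert x S) (addable S)"
    by (auto simp: inj_on_def addable_def)
  ultimately show ?thesis by (simp add: card_image)
qed

lemma card_down_covers:
  assumes "S \<in> shapes (Suc n)"
  shows "card {R \<in> shapes n. R \<subseteq> S} = card (removable S)"
proof -
  have "{R \<in> shapes n. R \<subseteq> S} = (\<lambda>x. S - {x}) ` removable S"
  proof (intro equalityI subsetI)
    fix R assume "R \<in> {R \<in> shapes n. R \<subseteq> S}"
    then have R: "R \<in> shapes n" "R \<subseteq> S" by auto
    then obtain x where "x \<notin> R" "S = insert x R" using shapes_Suc_obtain_cell assms by blast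
    then show "R \<in> (\<lambda>x. S - {x}) ` removable S"
      using R by (auto simp: removable_def shapes_def intro!: image_eqI[of _ _ x])
  qed (use assms in \<open>auto simp: removable_def shapes_def\<close>)
  moreover have "inj_on (\<lambda>x. S - {x}) (removable S)"
    by (auto simp: inj_on_def removable_def)
  ultimately show ?thesis by (simp add: card_image)
qed

text \<open>
  The addable cells are the ends of row \<open>0\<close> and of those rows that are shorter than the row above;
  the removable cells are the last cells of the rows that are longer than the row below. Sending an
  addable cell in row \<open>i + 1\<close> to the removable cell in row \<open>i\<close> matches all but the one in row \<open>0\<close>.
  The resulting excess of one is what is special to cells in the quarter plane; the off-diagonal
  part of \<open>D U - U D = 1\<close> holds in every lattice of order ideals.
\<close>

lemma card_addable:
  assumes "finite S" "order_ideal S"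
  shows "card (addable S) = card (removable S) + 1"
proof -
  \<comment> \<open>The row lengths, which encode \<open>S\<close> as a weakly decreasing sequence.\<close>
  define r where "r i = card {j. (i, j) \<in> S}" for i
  have fin_row: "finite {j. (i, j) \<in> S}" for i
    by (rule finite_subset[of _ "snd ` S"]) (use assms in force)+
  have mem: "(i, j) \<in> S \<longleftrightarrow> j < r i" for i j
  proof -
    have "\<exists>k. {j. (i, j) \<in> S} = {..<k}"
    proof (cases "{j. (i, j) \<in> S} = {}")
      case False
      let ?M = "Max {j. (i, j) \<in> S}"
      have "{j. (i, j) \<in> S} = {..<Suc ?M}"
        using Max_in[OF fin_row False] Max_ge[OF fin_row] assms(2)
        by (auto simp: less_Suc_eq_le dest: order_idealD)
      then show ?thesis by blast
    qed (auto intro: exI[of _ 0])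
    then obtain k where k: "{j. (i, j) \<in> S} = {..<k}" by blast
    then have "r i = k" by (simp add: r_def)
    then show ?thesis using k by auto
  qed
  have anti: "r i \<le> r i'" if "i' \<le> i" for i i'
  proof (rule ccontr)
    assume "\<not> r i \<le> r i'"
    then have "(i, r i') \<in> S" by (simp add: mem)
    then have "(i', r i') \<in> S" using that assms(2) by (auto dest: order_idealD)
    then show False by (simp add: mem)
  qed
  let ?J = "{i. r (Suc i) < r i}"
  have finJ: "finite ?J"
    by (rule finite_subset[of _ "fst ` S"]) (use assms mem in force)+
  have add: "addable S = (\<lambda>i. (i, r i)) ` (insert 0 (Suc ` ?J))"
  proof (intro equalityI subsetI)
    fix x assume x: "x \<in> addable S"
    obtain i j where ij: "x = (i, j)" by force
    have ni: "(i, j) \<notin> S" and I: "order_ideal (insert (i, j) S)"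
      using x ij by (auto simp: addable_def)
    have "(i, r i) \<in> insert (i, j) S"
      using order_idealD[OF I, of i j i "r i"] ni mem by auto
    then have j: "j = r i" by (auto simp: mem)
    have "i = 0 \<or> r i < r (i - 1)"
    proof (cases i)
      case (Suc k)
      have "(k, j) \<in> insert (i, j) S" using order_idealD[OF I, of i j k j] Suc by auto
      then show ?thesis using Suc j by (auto simp: mem)
    qed auto
    then have "i \<in> insert 0 (Suc ` ?J)" by (cases i) auto
    then show "x \<in> (\<lambda>i. (i, r i)) ` (insert 0 (Suc ` ?J))" using ij j by auto
  next
    fix x assume "x \<in> (\<lambda>i. (i, r i)) ` (insert 0 (Suc ` ?J))"
    then obtain i where i: "x = (i, r i)" "i = 0 \<or> (\<exists>k. i = Suc k \<and> r (Suc k) < r k)" by auto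
    have "(i', j') \<in> insert (i, r i) S" if le: "i' \<le> i" "j' \<le> r i" for i' j'
    proof (cases "i' = i")
      case False
      then obtain k where k: "i = Suc k" "r i < r k" using i(2) le by auto
      then have "r k \<le> r i'" using False le k by (intro anti) auto
      then show ?thesis using k le by (simp add: mem)
    qed (use le in \<open>auto simp: mem\<close>)
    then have "order_ideal (insert (i, r i) S)"
      using assms(2) unfolding order_ideal_def by blast
    then show "x \<in> addable S" by (simp add: addable_def i(1) mem)
  qed
  have rem: "removable S = (\<lambda>i. (i, r i - 1)) ` ?J"
  proof (intro equalityI subsetI)
    fix x assume x: "x \<in> removable S"
    obtain i j where ij: "x = (i, j)" by force
    have ni: "(i, j) \<in> S" and I: "order_ideal (S - {(i, j)})"
      using x ij by (auto simp: removable_def)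
    have "(i, Suc j) \<notin> S" "(Suc i, j) \<notin> S"
      using order_idealD[OF I, of i "Suc j" i j] order_idealD[OF I, of "Suc i" j i j] by auto
    then show "x \<in> (\<lambda>i. (i, r i - 1)) ` ?J"
      using ni ij by (auto simp: mem intro!: image_eqI[of _ _ i])
  next
    fix x assume "x \<in> (\<lambda>i. (i, r i - 1)) ` ?J"
    then obtain i where i: "x = (i, r i - 1)" "r (Suc i) < r i" by auto
    have "order_ideal (S - {x})"
      unfolding order_ideal_def
    proof (intro allI impI)
      fix a b a' b' assume a: "(a, b) \<in> S - {x} \<and> a' \<le> a \<and> b' \<le> b"
      then have "(a', b') \<in> S" using assms(2) by (auto dest: order_idealD)
      moreover have "(a', b') \<noteq> x"
      proof
        assume "(a', b') = x"
        then have e: "a' = i" "b' = r i - 1" using i by auto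
        show False
        proof (cases "a = i")
          case True
          then show False using a i e by (auto simp: mem)
        next
          case False
          then have "r a \<le> r (Suc i)" using a e by (intro anti) auto
          then show False using a i e by (auto simp: mem)
        qed
      qed
      ultimately show "(a', b') \<in> S - {x}" by simp
    qed
    then show "x \<in> removable S" using i by (auto simp: removable_def mem)
  qed
  have "card (addable S) = card (insert 0 (Suc ` ?J))"
    unfolding add by (rule card_image) (auto simp: inj_on_def)
  also have "\<dots> = Suc (card ?J)"
    using finJ by (subst card_insert_disjoint) (auto simp: card_image)
  also have "card ?J = card (removable S)"
    unfolding rem by (rule card_image[symmetric]) (auto simp: inj_on_def)
  finally show ?thesis by simp
qed

text \<open>
  A cell with maximal sum of coordinates can be removed.
\<close>

lemma removable_nonempty:
  assumes "finite S" "order_ideal S" "S \<noteq> {}"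
  shows "removable S \<noteq> {}"
proof -
  have "Max ((\<lambda>(i, j). i + j) ` S) \<in> (\<lambda>(i, j). i + j) ` S"
    using assms by (intro Max_in) auto
  then obtain i j where ij: "(i, j) \<in> S" "i + j = Max ((\<lambda>(i, j). i + j) ` S)" by auto
  have max: "a + b \<le> i + j" if "(a, b) \<in> S" for a b
    unfolding ij(2) using assms(1) that by (intro Max_ge) force+
  have "order_ideal (S - {(i, j)})"
    unfolding order_ideal_def
  proof (intro allI impI)
    fix a b a' b' assume a: "(a, b) \<in> S - {(i, j)} \<and> a' \<le> a \<and> b' \<le> b"
    then have "(a', b') \<in> S" using assms(2) by (auto dest: order_idealD)
    moreover have "(a', b') \<noteq> (i, j)"
      using a max[of a b] by auto
    ultimately show "(a', b') \<in> S - {(i, j)}" by simp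
  qed
  then show ?thesis using ij(1) by (auto simp: removable_def)
qed

lemma order_ideal_Un: "order_ideal S \<Longrightarrow> order_ideal T \<Longrightarrow> order_ideal (S \<union> T)"
  and order_ideal_Int: "order_ideal S \<Longrightarrow> order_ideal T \<Longrightarrow> order_ideal (S \<inter> T)"
  unfolding order_ideal_def by blast+

text \<open>
  The relation \<open>D U - U D = 1\<close>, entry by entry. Two different ideals of equal size can only have
  their union as common upper cover and their intersection as common lower cover, and by
  inclusion-exclusion the one is a cover exactly if the other is. The diagonal entries are the
  excess of addable over removable cells.
\<close>

lemma card_common_covers:
  assumes S: "S \<in> shapes (Suc l)" and S': "S' \<in> shapes (Suc l)"
  shows "card {T \<in> shapes (Suc (Suc l)). S \<subseteq> T \<and> S' \<subseteq> T}
       = card {R \<in> shapes l. R \<subseteq> S \<and> R \<subseteq> S'} + (if S = S' then 1 else 0)"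
proof (cases "S = S'")
  case True
  then show ?thesis
    using card_up_covers[OF S] card_down_covers[OF S] card_addable[of S] shapesD[OF S] by simp
next
  case False
  note f = shapesD[OF S] shapesD[OF S']
  have sum: "card (S \<union> S') + card (S \<inter> S') = Suc l + Suc l"
    using card_Un_Int[of S S'] f by simp
  have "card (S \<inter> S') \<noteq> Suc l"
  proof
    assume "card (S \<inter> S') = Suc l"
    then have "S \<inter> S' = S" "S \<inter> S' = S'"
      using f card_subset_eq[of S "S \<inter> S'"] card_subset_eq[of S' "S \<inter> S'"] by auto
    then show False using False by simp
  qed
  moreover have "card (S \<inter> S') \<le> Suc l" using f card_mono[of S "S \<inter> S'"] by auto
  ultimately have le: "card (S \<inter> S') \<le> l" by simp
  have up: "{T \<in> shapes (Suc (Suc l)). S \<subseteq> T \<and> S' \<subseteq> T}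
      = (if card (S \<inter> S') = l then {S \<union> S'} else {})" (is "?A = _")
  proof -
    have "T = S \<union> S'" if "T \<in> ?A" for T
      using that sum le card_seteq[of T "S \<union> S'"] by (auto simp: shapes_def)
    moreover have "S \<union> S' \<in> ?A \<longleftrightarrow> card (S \<inter> S') = l"
      using f sum by (auto simp: shapes_def order_ideal_Un)
    ultimately show ?thesis by auto
  qed
  have down: "{R \<in> shapes l. R \<subseteq> S \<and> R \<subseteq> S'}
      = (if card (S \<inter> S') = l then {S \<inter> S'} else {})" (is "?B = _")
  proof -
    have "R = S \<inter> S'" if "R \<in> ?B" for R
      using that f le card_seteq[of "S \<inter> S'" R] by (auto simp: shapes_def)
    moreover have "S \<inter> S' \<in> ?B \<longleftrightarrow> card (S \<inter> S') = l"
      using f by (auto simp: shapes_def order_ideal_Int)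
    ultimately show ?thesis by auto
  qed
  show ?thesis unfolding up down using False by simp
qed

section \<open>The up and down operators\<close>

text \<open>
  A vector on a level of Young's lattice is a function on shapes, of which only the values on that
  level count. In both operators \<open>l\<close> is the lower of the two levels involved.
\<close>

definition up :: "nat \<Rightarrow> ((nat \<times> nat) set \<Rightarrow> real) \<Rightarrow> (nat \<times> nat) set \<Rightarrow> real"
  where "up l w T = (\<Sum>S\<in>{S \<in> shapes l. S \<subseteq> T}. w S)"

definition down :: "nat \<Rightarrow> ((nat \<times> nat) set \<Rightarrow> real) \<Rightarrow> (nat \<times> nat) set \<Rightarrow> real"
  where "down l w S = (\<Sum>T\<in>{T \<in> shapes (Suc l). S \<subseteq> T}. w T)"

lemma up_down_adjoint:
  "(\<Sum>T\<in>shapes (Suc l). up l a T * b T) = (\<Sum>S\<in>shapes l. a S * down l b S)"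
  unfolding up_def down_def sum_distrib_left sum_distrib_right
  by (rule sum.swap_restrict) auto

lemma down_up_commutation:
  assumes S: "S \<in> shapes (Suc l)"
  shows "down (Suc l) (up (Suc l) w) S = up l (down l w) S + w S"
proof -
  have "down (Suc l) (up (Suc l) w) S
      = (\<Sum>S'\<in>shapes (Suc l). \<Sum>T\<in>{T \<in> {T \<in> shapes (Suc (Suc l)). S \<subseteq> T}. S' \<subseteq> T}. w S')"
    unfolding down_def up_def by (rule sum.swap_restrict) auto
  also have "\<dots> = (\<Sum>S'\<in>shapes (Suc l).
      real (card {T \<in> shapes (Suc (Suc l)). S \<subseteq> T \<and> S' \<subseteq> T}) * w S')"
    by (simp add: conj_assoc)
  also have "\<dots> = (\<Sum>S'\<in>shapes (Suc l).
      real (card {R \<in> shapes l. R \<subseteq> S \<and> R \<subseteq> S'}) * w S' + (if S = S' then w S' else 0))"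
    using card_common_covers[OF S] by (intro sum.cong) (auto simp: algebra_simps)
  also have "\<dots> = (\<Sum>S'\<in>shapes (Suc l).
      real (card {R \<in> shapes l. R \<subseteq> S \<and> R \<subseteq> S'}) * w S') + w S"
    using S by (simp add: sum.distrib)
  also have "(\<Sum>S'\<in>shapes (Suc l). real (card {R \<in> shapes l. R \<subseteq> S \<and> R \<subseteq> S'}) * w S')
      = (\<Sum>S'\<in>shapes (Suc l). \<Sum>R\<in>{R \<in> {R \<in> shapes l. R \<subseteq> S}. R \<subseteq> S'}. w S')"
    by (simp add: conj_assoc)
  also have "\<dots> = up l (down l w) S"
    unfolding down_def up_def by (rule sum.swap_restrict[symmetric]) auto
  finally show ?thesis .
qed

text \<open>
  \<open>\<parallel>U w\<parallel>\<^sup>2 = \<langle>w, D U w\<rangle> = \<langle>w, U D w\<rangle> + \<parallel>w\<parallel>\<^sup>2\<close>.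
\<close>

lemma norm_up:
  "(\<Sum>T\<in>shapes (Suc (Suc l)). (up (Suc l) w T)\<^sup>2)
   = (\<Sum>R\<in>shapes l. (down l w R)\<^sup>2) + (\<Sum>S\<in>shapes (Suc l). (w S)\<^sup>2)"
proof -
  have "(\<Sum>T\<in>shapes (Suc (Suc l)). (up (Suc l) w T)\<^sup>2)
      = (\<Sum>S\<in>shapes (Suc l). w S * down (Suc l) (up (Suc l) w) S)"
    unfolding power2_eq_square by (rule up_down_adjoint)
  also have "\<dots> = (\<Sum>S\<in>shapes (Suc l). up l (down l w) S * w S + (w S)\<^sup>2)"
    by (intro sum.cong) (auto simp: down_up_commutation algebra_simps power2_eq_square)
  also have "\<dots> = (\<Sum>R\<in>shapes l. (down l w R)\<^sup>2) + (\<Sum>S\<in>shapes (Suc l). (w S)\<^sup>2)"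
    by (simp add: sum.distrib up_down_adjoint power2_eq_square)
  finally show ?thesis .
qed

text \<open>
  The key inequality. With \<open>a\<close>, \<open>b\<close>, \<open>c\<close> the squared norms of \<open>v\<close>, \<open>D v\<close>, \<open>D\<^sup>2 v\<close>, it says that
  \<open>c / b \<ge> b / a - 1\<close>. It is the Cauchy--Schwarz inequality \<open>\<langle>U D v, v\<rangle>\<^sup>2 \<le> \<parallel>U D v\<parallel>\<^sup>2 \<parallel>v\<parallel>\<^sup>2\<close>, in which
  the left side is \<open>b\<^sup>2\<close> by adjointness and \<open>\<parallel>U D v\<parallel>\<^sup>2 = c + b\<close> by the commutation relation.
\<close>

lemma norm_down_ratio:
  fixes v :: "(nat \<times> nat) set \<Rightarrow> real" and l :: nat
  defines "w \<equiv> down (Suc l) v"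
  defines "a \<equiv> (\<Sum>T\<in>shapes (Suc (Suc l)). (v T)\<^sup>2)"
    and "b \<equiv> (\<Sum>S\<in>shapes (Suc l). (w S)\<^sup>2)"
    and "c \<equiv> (\<Sum>R\<in>shapes l. (down l w R)\<^sup>2)"
  shows "b * (b - a) \<le> c * a"
proof -
  have "b = (\<Sum>T\<in>shapes (Suc (Suc l)). up (Suc l) w T * v T)"
    unfolding up_down_adjoint b_def by (simp add: w_def power2_eq_square)
  then have "b\<^sup>2 \<le> (\<Sum>T\<in>shapes (Suc (Suc l)). (up (Suc l) w T)\<^sup>2) * a"
    unfolding a_def by (simp only: Cauchy_Schwarz_ineq_sum)
  then have "b\<^sup>2 \<le> (c + b) * a"
    unfolding norm_up b_def c_def .
  then show ?thesis by (simp add: algebra_simps power2_eq_square)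
qed

section \<open>Skew tableaux as paths in Young's lattice\<close>

definition skew_count :: "(nat \<times> nat) set \<Rightarrow> (nat \<times> nat) set \<Rightarrow> nat"
  where "skew_count S T = (if S \<subseteq> T then card (standard_tableaux (T - S)) else 0)"

lemma num_skew_syt_eq: "num_skew_syt lam mu = skew_count (young_diagram mu) (young_diagram lam)"
  by (simp add: num_skew_syt_def skew_count_def)

lemma num_syt_eq: "num_syt lam = skew_count {} (young_diagram lam)"
  by (simp add: num_syt_def num_skew_syt_eq young_diagram_def)

lemma finite_standard_tableaux:
  assumes "finite D"
  shows "finite (standard_tableaux D)"
proof (rule finite_subset)
  show "standard_tableaux D \<subseteq> (\<Pi>\<^sub>E x\<in>D. {1..card D})"
    by (auto simp: standard_tableaux_def PiE_def dest: bij_betwE)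
qed (use assms in \<open>auto intro: finite_PiE\<close>)

lemma skew_count_same_size:
  assumes "S \<in> shapes n" "T \<in> shapes n"
  shows "skew_count S T = (if S = T then 1 else 0)"
proof -
  have "standard_tableaux {} = {\<lambda>_. undefined}"
    by (auto simp: standard_tableaux_def bij_betw_def)
  then show ?thesis
    using shapes_same_size_subset[OF assms] by (auto simp: skew_count_def)
qed

text \<open>
  Deleting the largest entry from a tableau, and putting it back, are inverse to each other. The
  largest entry can be put into \<open>x\<close> because no cell of \<open>T\<close> lies to the right of or below \<open>x\<close>.
\<close>

lemma card_standard_tableaux_top:
  assumes S: "order_ideal S" "finite T" "S \<subseteq> T" "x \<in> T" "x \<notin> S"
    and T: "order_ideal T" and T': "order_ideal (T - {x})"
  shows "card {t \<in> standard_tableaux (T - S). t x = card (T - S)}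
       = card (standard_tableaux (T - {x} - S))"
proof -
  define D where "D = T - S"
  define N where "N = card D"
  have fin: "finite D" and x: "x \<in> D" using S by (auto simp: D_def)
  have D': "T - {x} - S = D - {x}" by (auto simp: D_def)
  have N: "N = Suc (card (D - {x}))"
    unfolding N_def using fin x by (rule card.remove)
  have right: "j' < snd x" if "(fst x, j') \<in> D" "j' \<noteq> snd x" for j'
    using order_idealD[OF T', of "fst x" j' "fst x" "snd x"] that
    by (cases "snd x \<le> j'") (auto simp: D_def prod_eq_iff)
  have below: "i' < fst x" if "(i', snd x) \<in> D" "i' \<noteq> fst x" for i'
    using order_idealD[OF T', of i' "snd x" "fst x" "snd x"] that
    by (cases "fst x \<le> i'") (auto simp: D_def prod_eq_iff)
  have "bij_betw (\<lambda>t. t(x := undefined)) {t \<in> standard_tableaux D. t x = N}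
      (standard_tableaux (D - {x}))"
  proof (rule bij_betw_byWitness[where f' = "\<lambda>t. t(x := N)"])
    show "\<forall>t\<in>{t \<in> standard_tableaux D. t x = N}. (t(x := undefined))(x := N) = t" by auto
    show "\<forall>t\<in>standard_tableaux (D - {x}). (t(x := N))(x := undefined) = t"
      by (cases x) (auto simp: standard_tableaux_def extensional_def fun_upd_idem_iff)
    show "(\<lambda>t. t(x := undefined)) ` {t \<in> standard_tableaux D. t x = N}
        \<subseteq> standard_tableaux (D - {x})"
    proof clarify
      fix t assume t: "t \<in> standard_tableaux D" "N = t x"
      have b: "bij_betw t D {1..N}" using t by (simp add: standard_tableaux_def N_def)
      have "bij_betw t (D - {x}) ({1..N} - {t x})"
        using b x inj_on_image_set_diff[of t D D "{x}"]
        by (auto simp: bij_betw_def intro: inj_on_diff)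
      moreover have "{1..N} - {t x} = {1..card (D - {x})}" using t(2) N by auto
      ultimately have "bij_betw (t(x := undefined)) (D - {x}) {1..card (D - {x})}"
        by (subst bij_betw_cong[of _ _ t]) auto
      then show "t(x := undefined) \<in> standard_tableaux (D - {x})"
        using t(1) unfolding standard_tableaux_def extensional_def by auto
    qed
    show "(\<lambda>t. t(x := N)) ` standard_tableaux (D - {x})
        \<subseteq> {t \<in> standard_tableaux D. t x = N}"
    proof clarify
      fix t assume t: "t \<in> standard_tableaux (D - {x})"
      have b: "bij_betw t (D - {x}) {1..card (D - {x})}"
        using t by (simp add: standard_tableaux_def)
      have lt: "t y < N" if "y \<in> D" "y \<noteq> x" for y
        using bij_betwE[OF b] that N by (simp add: less_Suc_eq_le)
      have "bij_betw (t(x := N)) (D - {x}) {1..card (D - {x})}"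
        using b by (subst bij_betw_cong[of _ _ t]) auto
      then have "bij_betw (t(x := N)) (D - {x} \<union> {x}) ({1..card (D - {x})} \<union> {N})"
        by (rule bij_betw_combine) (auto simp: N bij_betw_def)
      moreover have "D - {x} \<union> {x} = D" using x by auto
      moreover have "{1..card (D - {x})} \<union> {N} = {1..N}" using N by auto
      ultimately have "bij_betw (t(x := N)) D {1..N}" by simp
      moreover have "t(x := N) \<in> extensional D"
        using t x by (auto simp: standard_tableaux_def extensional_def)
      moreover have "(t(x := N)) (i, j) < (t(x := N)) (i, j')"
        if "(i, j) \<in> D" "(i, j') \<in> D" "j < j'" for i j j'
        using that lt[of "(i, j)"] right[of j'] t
        by (cases x) (auto simp: standard_tableaux_def)
      moreover have "(t(x := N)) (i, j) < (t(x := N)) (i', j)"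
        if "(i, j) \<in> D" "(i', j) \<in> D" "i < i'" for i i' j
        using that lt[of "(i, j)"] below[of i'] t
        by (cases x) (auto simp: standard_tableaux_def)
      ultimately show "t(x := N) \<in> standard_tableaux D \<and> (t(x := N)) x = N"
        unfolding standard_tableaux_def N_def by auto
    qed
  qed
  then show ?thesis using bij_betw_same_card by (fastforce simp: D' D_def N_def)
qed

lemma top_cell_removable:
  assumes "order_ideal S" "order_ideal T" "S \<subseteq> T" "x \<in> T - S"
    and t: "t \<in> standard_tableaux (T - S)" "t x = card (T - S)"
  shows "order_ideal (T - {x})"
  unfolding order_ideal_def
proof (intro allI impI)
  obtain i j where x: "x = (i, j)" by force
  fix a b a' b' assume a: "(a, b) \<in> T - {x} \<and> a' \<le> a \<and> b' \<le> b"
  then have "(a', b') \<in> T" using assms(2) by (auto dest: order_idealD)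
  moreover have "(a', b') \<noteq> x"
  proof
    assume "(a', b') = x"
    then have ab: "i \<le> a" "j \<le> b" "(a, b) \<noteq> (i, j)" using a x by auto
    have D: "(i, b) \<in> T - S" "(a, b) \<in> T - S"
      using ab a assms(1,2,4) x by (auto dest: order_idealD)
    have "t (i, j) \<le> t (i, b)"
      using t(1) D assms(4) ab x unfolding standard_tableaux_def
      by (cases "j = b") (auto intro!: less_imp_le)
    moreover have "t (i, b) \<le> t (a, b)"
      using t(1) D ab unfolding standard_tableaux_def
      by (cases "i = a") (auto intro!: less_imp_le)
    moreover have bij: "bij_betw t (T - S) {1..card (T - S)}"
      using t(1) by (simp add: standard_tableaux_def)
    have "t (a, b) \<le> t (i, j)" using bij_betwE[OF bij] D t(2) x by auto
    ultimately have "t (a, b) = t (i, j)" by simp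
    then show False
      using bij D assms(4) ab x by (auto simp: bij_betw_def inj_on_def)
  qed
  ultimately show "(a', b') \<in> T - {x}" by simp
qed

text \<open>
  Classify the tableaux by the cell of their largest entry. The assumption \<open>l \<le> n\<close> ensures that there is
  an entry at all.
\<close>

lemma skew_count_remove_top:
  assumes S: "S \<in> shapes l" and T: "T \<in> shapes (Suc n)" and "l \<le> n"
  shows "skew_count S T = (\<Sum>T'\<in>{T' \<in> shapes n. T' \<subseteq> T}. skew_count S T')"
proof (cases "S \<subseteq> T")
  case False
  then have "skew_count S T' = 0" if "T' \<subseteq> T" for T'
    using that by (auto simp: skew_count_def)
  then show ?thesis using False by (simp add: skew_count_def)
next
  case True
  note f = shapesD[OF S] shapesD[OF T]
  let ?D = "T - S"
  let ?X = "{x \<in> removable T. x \<notin> S}"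
  let ?F = "\<lambda>x. {t \<in> standard_tableaux ?D. t x = card ?D}"
  have finX: "finite ?X" using f by (auto simp: removable_def)
  have cD: "card ?D \<ge> 1"
    using f True assms(3) by (simp add: card_Diff_subset)
  have "standard_tableaux ?D = (\<Union>x\<in>?X. ?F x)"
  proof (intro equalityI subsetI)
    fix t assume t: "t \<in> standard_tableaux ?D"
    then have b: "bij_betw t ?D {1..card ?D}" by (simp add: standard_tableaux_def)
    then obtain x where x: "x \<in> ?D" "t x = card ?D"
      using cD bij_betw_imp_surj_on[OF b] by (metis atLeastAtMost_iff imageE order_refl)
    then have "x \<in> ?X"
      using top_cell_removable[of S T x t] f True t by (auto simp: removable_def)
    then show "t \<in> (\<Union>x\<in>?X. ?F x)" using t x by (intro UN_I[of x]) auto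
  qed auto
  moreover have "?F x \<inter> ?F y = {}" if "x \<in> ?X" "y \<in> ?X" "x \<noteq> y" for x y
    using that by (auto simp: standard_tableaux_def bij_betw_def removable_def inj_on_def)
  moreover have "finite (standard_tableaux ?D)"
    using f by (simp add: finite_standard_tableaux)
  ultimately have "card (standard_tableaux ?D) = (\<Sum>x\<in>?X. card (?F x))"
    using finX card_UN_disjoint[of ?X ?F] by (metis (no_types, lifting) finite_UN)
  also have "\<dots> = (\<Sum>x\<in>?X. skew_count S (T - {x}))"
  proof (intro sum.cong refl)
    fix x assume x: "x \<in> ?X"
    then have "S \<subseteq> T - {x}" using True by auto
    then show "card (?F x) = skew_count S (T - {x})"
      using card_standard_tableaux_top[of S T x] x f True
      by (auto simp: removable_def skew_count_def)
  qed
  also have "\<dots> = (\<Sum>T'\<in>(\<lambda>x. T - {x}) ` ?X. skew_count S T')"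
    by (subst sum.reindex) (auto simp: inj_on_def removable_def)
  also have "\<dots> = (\<Sum>T'\<in>{T' \<in> shapes n. T' \<subseteq> T}. skew_count S T')"
  proof (rule sum.mono_neutral_left)
    show "(\<lambda>x. T - {x}) ` ?X \<subseteq> {T' \<in> shapes n. T' \<subseteq> T}"
      using f by (auto simp: shapes_def removable_def)
    show "\<forall>T'\<in>{T' \<in> shapes n. T' \<subseteq> T} - (\<lambda>x. T - {x}) ` ?X. skew_count S T' = 0"
    proof
      fix T' assume T': "T' \<in> {T' \<in> shapes n. T' \<subseteq> T} - (\<lambda>x. T - {x}) ` ?X"
      then obtain x where x: "x \<notin> T'" "T = insert x T'"
        using shapes_Suc_obtain_cell[of T' n T] T by blast
      then have eq: "T' = T - {x}" and "x \<in> T" by blast+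
      moreover have "order_ideal (T - {x})"
        unfolding eq[symmetric] using T' by (simp add: shapes_def)
      ultimately have "x \<in> removable T" by (simp add: removable_def)
      then have "x \<in> S" using T' eq by blast
      then show "skew_count S T' = 0" using x by (auto simp: skew_count_def)
    qed
  qed auto
  finally show ?thesis using True by (simp add: skew_count_def)
qed

text \<open>
  Deleting the smallest entry would change all the others. Both recursions, however, count the
  saturated chains from \<open>S\<close> to \<open>T\<close>, so this one follows from the preceding one by induction.
\<close>

lemma skew_count_remove_bottom:
  assumes S: "S \<in> shapes l" and T: "T \<in> shapes n" and "l < n"
  shows "skew_count S T = (\<Sum>S'\<in>{S' \<in> shapes (Suc l). S \<subseteq> S'}. skew_count S' T)"
  using T \<open>l < n\<close>
proof (induction n arbitrary: T)
  case (Suc n)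
  show ?case
  proof (cases "l = n")
    case True
    have "skew_count S T = (\<Sum>T'\<in>{T' \<in> shapes n. T' \<subseteq> T}. skew_count S T')"
      using skew_count_remove_top[OF S Suc.prems(1)] True by simp
    also have "\<dots> = (\<Sum>T'\<in>{T' \<in> shapes n. T' \<subseteq> T}. if S = T' then 1 else 0)"
      using S True by (intro sum.cong) (auto simp: skew_count_same_size)
    also have "\<dots> = (\<Sum>S'\<in>{S' \<in> shapes (Suc l). S \<subseteq> S'}. if S' = T then 1 else 0)"
      using S Suc.prems True by simp
    also have "\<dots> = (\<Sum>S'\<in>{S' \<in> shapes (Suc l). S \<subseteq> S'}. skew_count S' T)"
      using Suc.prems(1) True by (intro sum.cong) (auto simp: skew_count_same_size[of _ "Suc n"])
    finally show ?thesis .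
  next
    case False
    have "skew_count S T = (\<Sum>T'\<in>{T' \<in> shapes n. T' \<subseteq> T}. skew_count S T')"
      using skew_count_remove_top[OF S Suc.prems(1)] Suc.prems by simp
    also have "\<dots> = (\<Sum>T'\<in>{T' \<in> shapes n. T' \<subseteq> T}.
        \<Sum>S'\<in>{S' \<in> shapes (Suc l). S \<subseteq> S'}. skew_count S' T')"
      using Suc False by (intro sum.cong) auto
    also have "\<dots> = (\<Sum>S'\<in>{S' \<in> shapes (Suc l). S \<subseteq> S'}.
        \<Sum>T'\<in>{T' \<in> shapes n. T' \<subseteq> T}. skew_count S' T')"
      by (rule sum.swap)
    also have "\<dots> = (\<Sum>S'\<in>{S' \<in> shapes (Suc l). S \<subseteq> S'}. skew_count S' T)"
      using Suc.prems False skew_count_remove_top[of _ "Suc l" T n]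
      by (intro sum.cong) auto
    finally show ?thesis .
  qed
qed simp

abbreviation syt_count :: "(nat \<times> nat) set \<Rightarrow> real"
  where "syt_count T \<equiv> real (skew_count {} T)"

lemma syt_count_empty: "syt_count {} = 1"
  using skew_count_same_size[of "{}" 0 "{}"] by simp

lemma syt_count_up:
  assumes "T \<in> shapes (Suc l)"
  shows "syt_count T = up l syt_count T"
  using skew_count_remove_top[of "{}" 0 T l] assms by (simp add: up_def)

lemma skew_count_down:
  assumes "S \<in> shapes l" "T \<in> shapes n" "l < n"
  shows "real (skew_count S T) = down l (\<lambda>S. real (skew_count S T)) S"
  using skew_count_remove_bottom[OF assms] by (simp add: down_def)

text \<open>
  The vector of all numbers of standard tableaux on level \<open>l\<close> is \<open>U\<^sup>l\<close> applied to the empty shape,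
  which \<open>D\<close> annihilates. Hence \<open>D\<close> acts on the powers \<open>U\<^sup>l\<close> like differentiation.
\<close>

lemma down_syt_count:
  assumes "S \<in> shapes l"
  shows "down l syt_count S = real (Suc l) * syt_count S"
  using assms
proof (induction l arbitrary: S)
  case 0
  have "syt_count T = 1" if "T \<in> shapes (Suc 0)" for T
  proof -
    have "{S \<in> shapes 0. S \<subseteq> T} = {{}}" by auto
    then show ?thesis
      using syt_count_up[OF that] by (simp add: up_def syt_count_empty)
  qed
  moreover have "card {T \<in> shapes (Suc 0). {} \<subseteq> T} = 1"
    using card_up_covers[of "{}" 0] card_addable[of "{}"]
    by (simp add: order_ideal_def removable_def)
  ultimately show ?case
    using 0 by (simp add: down_def syt_count_empty)
next
  case (Suc l)
  have "down (Suc l) syt_count S = down (Suc l) (up (Suc l) syt_count) S"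
    unfolding down_def by (intro sum.cong) (auto simp: syt_count_up)
  also have "\<dots> = up l (down l syt_count) S + syt_count S"
    by (rule down_up_commutation[OF Suc.prems])
  also have "up l (down l syt_count) S = up l (\<lambda>R. real (Suc l) * syt_count R) S"
    unfolding up_def by (intro sum.cong) (auto simp: Suc.IH)
  also have "\<dots> = real (Suc l) * syt_count S"
    by (simp only: syt_count_up[OF Suc.prems]) (simp add: up_def sum_distrib_left)
  finally show ?case by (simp add: algebra_simps)
qed

text \<open>
  This pairs \<open>U\<^sup>n\<close> of the empty shape with \<open>U\<^bsup>n-l\<^esup> S\<close>; moving the second power to the other
  side applies \<open>down_syt_count\<close> \<open>n - l\<close> times.
\<close>

lemma sum_syt_count_skew_count:
  assumes "l \<le> n" "S \<in> shapes l"
  shows "(\<Sum>T\<in>shapes n. syt_count T * real (skew_count S T)) = fact n / fact l * syt_count S"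
  using assms
proof (induction l arbitrary: S rule: inc_induct)
  case base
  then have "(\<Sum>T\<in>shapes n. syt_count T * real (skew_count S T))
      = (\<Sum>T\<in>shapes n. if S = T then syt_count T else 0)"
    by (intro sum.cong) (auto simp: skew_count_same_size)
  then show ?case using base by simp
next
  case (step l)
  have "(\<Sum>T\<in>shapes n. syt_count T * real (skew_count S T))
      = (\<Sum>T\<in>shapes n. \<Sum>S'\<in>{S' \<in> shapes (Suc l). S \<subseteq> S'}. syt_count T * real (skew_count S' T))"
    using step by (intro sum.cong) (auto simp: skew_count_remove_bottom[of S l] sum_distrib_left)
  also have "\<dots> = (\<Sum>S'\<in>{S' \<in> shapes (Suc l). S \<subseteq> S'}.
      \<Sum>T\<in>shapes n. syt_count T * real (skew_count S' T))"
    by (rule sum.swap)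
  also have "\<dots> = (\<Sum>S'\<in>{S' \<in> shapes (Suc l). S \<subseteq> S'}. fact n / fact (Suc l) * syt_count S')"
    using step by (intro sum.cong) auto
  also have "\<dots> = fact n / fact (Suc l) * down l syt_count S"
    by (simp add: down_def sum_distrib_left)
  also have "\<dots> = fact n / fact l * syt_count S"
    using down_syt_count[OF step.prems] by (simp add: divide_simps)
  finally show ?case .
qed

lemma syt_count_mult_skew_count_le:
  assumes "l \<le> n" "S \<in> shapes l" "T \<in> shapes n"
  shows "syt_count T * real (skew_count S T) \<le> fact n / fact l * syt_count S"
  unfolding sum_syt_count_skew_count[OF assms(1,2), symmetric]
  by (rule member_le_sum) (use assms in auto)

lemma syt_count_le_sqrt_fact:
  assumes "T \<in> shapes n"
  shows "syt_count T \<le> sqrt (fact n)"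
  using syt_count_mult_skew_count_le[of 0 n "{}" T] assms
  by (simp add: syt_count_empty power2_eq_square real_le_rsqrt)

text \<open>
  For \<open>T\<close> of size \<open>n\<close> this is the squared norm of \<open>D\<^bsup>n-l\<^esup> T\<close>.
\<close>

definition sum_squares :: "(nat \<times> nat) set \<Rightarrow> nat \<Rightarrow> real"
  where "sum_squares T l = (\<Sum>S\<in>shapes l. (real (skew_count S T))\<^sup>2)"

lemma sum_squares_top:
  assumes "T \<in> shapes n"
  shows "sum_squares T n = 1"
proof -
  have "sum_squares T n = (\<Sum>S\<in>shapes n. if S = T then 1 else 0)"
    unfolding sum_squares_def using assms
    by (intro sum.cong) (auto simp: skew_count_same_size)
  then show ?thesis using assms by simp
qed

lemma sum_squares_ratio:
  assumes "T \<in> shapes n" "Suc (Suc l) \<le> n"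
  shows "sum_squares T (Suc l) * (sum_squares T (Suc l) - sum_squares T (Suc (Suc l)))
       \<le> sum_squares T l * sum_squares T (Suc (Suc l))"
proof -
  let ?v = "\<lambda>S. real (skew_count S T)"
  have *: "down (Suc l) ?v S = ?v S" if "S \<in> shapes (Suc l)" for S
    using skew_count_down[OF that assms(1)] assms(2) by simp
  have **: "down l (down (Suc l) ?v) S = ?v S" if "S \<in> shapes l" for S
  proof -
    have "down l (down (Suc l) ?v) S = down l ?v S"
      unfolding down_def[of l] by (intro sum.cong) (auto simp: *)
    then show ?thesis using skew_count_down[OF that assms(1)] assms(2) by simp
  qed
  show ?thesis
    using norm_down_ratio[of l ?v] by (simp add: * ** sum_squares_def)
qed

text \<open>
  Every shape of positive size covers at least one other, so a chain from \<open>T\<close> down to level \<open>k\<close> can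
  be continued to level \<open>l\<close>.
\<close>

lemma sum_skew_count_mono:
  assumes T: "T \<in> shapes n" and l: "l \<le> k" "k \<le> n"
  shows "(\<Sum>S\<in>shapes k. real (skew_count S T)) \<le> (\<Sum>S\<in>shapes l. real (skew_count S T))"
  using l(1)
proof (induction l rule: inc_induct)
  case (step l)
  let ?v = "\<lambda>S. real (skew_count S T)"
  have "1 \<le> up l (\<lambda>_. 1) S" if S: "S \<in> shapes (Suc l)" for S
  proof -
    have "S \<noteq> {}" using shapesD(3)[OF S] by auto
    then have "removable S \<noteq> {}" "finite (removable S)"
      using shapesD[OF S] removable_nonempty[of S] by (auto simp: removable_def)
    then have "card (removable S) \<ge> 1" by (simp add: Suc_le_eq card_gt_0_iff)
    then show ?thesis using card_down_covers[OF S] by (simp add: up_def)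
  qed
  then have "(\<Sum>S\<in>shapes (Suc l). ?v S) \<le> (\<Sum>S\<in>shapes (Suc l). up l (\<lambda>_. 1) S * ?v S)"
    by (intro sum_mono) (use mult_right_mono[of 1] in fastforce)
  also have "\<dots> = (\<Sum>S\<in>shapes l. down l ?v S)"
    by (simp add: up_down_adjoint)
  also have "\<dots> = (\<Sum>S\<in>shapes l. ?v S)"
    using skew_count_down[OF _ T] step l by (intro sum.cong) auto
  finally show ?case using step.IH by linarith
qed simp

lemma sum_squares_pos:
  assumes T: "T \<in> shapes n" and "l \<le> n"
  shows "sum_squares T l > 0"
proof -
  have "(\<Sum>S\<in>shapes n. real (skew_count S T)) = (\<Sum>S\<in>shapes n. if S = T then 1 else 0)"
    using T by (intro sum.cong) (auto simp: skew_count_same_size)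
  then have "1 \<le> (\<Sum>S\<in>shapes l. real (skew_count S T))"
    using sum_skew_count_mono[OF T assms(2)] T by simp
  then obtain S where "S \<in> shapes l" "skew_count S T \<noteq> 0"
    by (metis (no_types, lifting) not_one_le_zero of_nat_0 sum.neutral)
  then show ?thesis unfolding sum_squares_def by (intro sum_pos2[of _ S]) auto
qed

lemma sum_squares_le_syt_count:
  assumes T: "T \<in> shapes n" and "l \<le> n"
  shows "sum_squares T l \<le> (syt_count T)\<^sup>2"
proof -
  let ?v = "\<lambda>S. real (skew_count S T)"
  have "sum_squares T l = (\<Sum>S\<in>shapes l. ?v S * ?v S)"
    by (simp add: sum_squares_def power2_eq_square)
  also have "\<dots> \<le> (\<Sum>S\<in>shapes l. ?v S * (\<Sum>S\<in>shapes l. ?v S))"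
    by (intro sum_mono mult_left_mono member_le_sum) auto
  also have "\<dots> = (\<Sum>S\<in>shapes l. ?v S)\<^sup>2"
    by (simp add: sum_distrib_right power2_eq_square)
  also have "\<dots> \<le> (syt_count T)\<^sup>2"
    using sum_skew_count_mono[OF T, of 0 l] assms(2) by (intro power_mono) (auto intro: sum_nonneg)
  finally show ?thesis .
qed

section \<open>Descent along a sequence with monotone ratio defects\<close>

text \<open>
  With the defect \<open>\<delta> i = (i + 1) - Q i / Q (i + 1)\<close>, the third assumption says that \<open>\<delta>\<close> is weakly
  increasing. A large \<open>\<delta> k\<close> would therefore depress all the steps from \<open>n\<close> to \<open>k\<close>, which are at least
  half of \<open>n\<close> many, and contradict the lower bound for \<open>Q k\<close>. This gives \<open>\<delta> i \<le> 2 L\<close> for all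
  \<open>i \<le> k\<close>, and so \<open>Q i / Q (i + 1) \<ge> (i + 1) / 2\<close> as long as \<open>i + 1 \<ge> 4 L\<close>. The last assumption is a
  condition on the levels between \<open>m\<close> and \<open>k\<close> only, so that \<open>m = k\<close> is always permitted.
\<close>

lemma ratio_defect_descent:
  fixes Q :: "nat \<Rightarrow> real" and L :: real
  assumes pos: "\<And>l. l \<le> n \<Longrightarrow> Q l > 0" and top: "Q n = 1"
    and ratio: "\<And>l. Suc (Suc l) \<le> n \<Longrightarrow>
        Q (Suc l) * (Q (Suc l) - Q (Suc (Suc l))) \<le> Q l * Q (Suc (Suc l))"
    and k: "2 * k \<le> n" "0 < n" and "L \<ge> 0"
    and large: "Q k \<ge> fact n / fact k * exp (- L)"
    and m: "m \<le> k" "\<And>i. m < i \<Longrightarrow> i \<le> k \<Longrightarrow> 4 * L \<le> real i"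
  shows "Q m \<ge> fact n / fact m * exp (- L) / 2 ^ (k - m)"
proof -
  define \<delta> where "\<delta> i = real (Suc i) - Q i / Q (Suc i)" for i
  have Q_step: "Q i = (real (Suc i) - \<delta> i) * Q (Suc i)" if "i < n" for i
    using pos[of "Suc i"] that by (simp add: \<delta>_def)
  have \<delta>_Suc: "\<delta> i \<le> \<delta> (Suc i)" if "Suc i < n" for i
    using ratio[of i] pos[of "Suc i"] pos[of "Suc (Suc i)"] that
    by (simp add: \<delta>_def divide_simps algebra_simps)
  have \<delta>_mono: "\<delta> i \<le> \<delta> j" if "i \<le> j" "j < n" for i j
    using that
  proof (induction j rule: dec_induct)
    case (step j)
    then show ?case using \<delta>_Suc[of j] by simp
  qed simp
  have \<delta>_le: "\<delta> k \<le> 2 * L"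
  proof (rule ccontr)
    assume "\<not> \<delta> k \<le> 2 * L"
    then have d: "\<delta> k > 2 * L" "\<delta> k > 0" using \<open>L \<ge> 0\<close> by auto
    have "k \<le> n" using k by simp
    then have "Q k \<le> fact n / fact k * exp (- (\<delta> k / n) * real (n - k))"
    proof (rule inc_induct[where P = "\<lambda>i. Q i \<le> fact n / fact i * exp (- (\<delta> k / n) * real (n - i))"])
      show "Q n \<le> fact n / fact n * exp (- (\<delta> k / n) * real (n - n))" using top by simp
    next
      fix i assume i: "k \<le> i" "i < n"
        and IH: "Q (Suc i) \<le> fact n / fact (Suc i) * exp (- (\<delta> k / n) * real (n - Suc i))"
      have "real (Suc i) * (\<delta> k / n) \<le> n * (\<delta> k / n)"
        using i d by (intro mult_right_mono) auto
      then have "real (Suc i) - \<delta> i \<le> real (Suc i) * (1 - \<delta> k / n)"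
        using \<delta>_mono[OF i] k by (simp add: algebra_simps)
      also have "\<dots> \<le> real (Suc i) * exp (- (\<delta> k / n))"
        using exp_ge_add_one_self[of "- (\<delta> k / n)"] by (intro mult_left_mono) auto
      finally have "Q i \<le> real (Suc i) * exp (- (\<delta> k / n)) * Q (Suc i)"
        using Q_step[OF i(2)] pos[of "Suc i"] i by (simp add: mult_right_mono)
      also have "\<dots> \<le> real (Suc i) * exp (- (\<delta> k / n)) *
          (fact n / fact (Suc i) * exp (- (\<delta> k / n) * real (n - Suc i)))"
        using IH by (intro mult_left_mono) auto
      also have "\<dots> = fact n / fact i * (exp (- (\<delta> k / n)) * exp (- (\<delta> k / n) * real (n - Suc i)))"
        by (simp add: divide_simps)
      also have "exp (- (\<delta> k / n)) * exp (- (\<delta> k / n) * real (n - Suc i))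
          = exp (- (\<delta> k / n) * real (n - i))"
        unfolding exp_add[symmetric] Suc_diff_Suc[OF i(2), symmetric]
        by (simp add: algebra_simps)
      finally show "Q i \<le> fact n / fact i * exp (- (\<delta> k / n) * real (n - i))" .
    qed
    with large have "fact n / fact k * exp (- L) \<le> fact n / fact k * exp (- (\<delta> k / n) * real (n - k))"
      by linarith
    then have "exp (- L) \<le> exp (- (\<delta> k / n) * real (n - k))"
      by (subst (asm) mult_le_cancel_left_pos) auto
    then have "\<delta> k / n * real (n - k) \<le> L" by simp
    moreover have "\<delta> k / n * real (n - k) \<ge> \<delta> k / n * (n / 2)"
      using d k by (intro mult_left_mono) (auto simp: of_nat_diff)
    ultimately have "\<delta> k / n * (n / 2) \<le> L" by linarith
    then show False using d k by simp
  qed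
  from m(1) show ?thesis
  proof (rule inc_induct[where P = "\<lambda>i. Q i \<ge> fact n / fact i * exp (- L) / 2 ^ (k - i)"])
    show "Q k \<ge> fact n / fact k * exp (- L) / 2 ^ (k - k)" using large by simp
  next
    fix i assume i: "m \<le> i" "i < k"
      and IH: "Q (Suc i) \<ge> fact n / fact (Suc i) * exp (- L) / 2 ^ (k - Suc i)"
    have "4 * L \<le> real (Suc i)" using m(2)[of "Suc i"] i by simp
    then have "real (Suc i) / 2 \<le> real (Suc i) - \<delta> i"
      using \<delta>_mono[of i k] \<delta>_le i k by simp
    then have "real (Suc i) / 2 * (fact n / fact (Suc i) * exp (- L) / 2 ^ (k - Suc i)) \<le> Q i"
      unfolding Q_step[of i, OF less_le_trans[OF i(2), of n, OF order_trans[OF _ k(1)]], simplified]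
      using IH by (intro mult_mono) auto
    moreover have "real (Suc i) / 2 * (fact n / fact (Suc i) * exp (- L) / 2 ^ (k - Suc i))
        = fact n / fact i * exp (- L) / 2 ^ (k - i)"
      using i by (simp add: Suc_diff_Suc[symmetric] divide_simps)
    ultimately show "Q i \<ge> fact n / fact i * exp (- L) / 2 ^ (k - i)" by (simp only:)
  qed
qed

section \<open>Lower bounds for the numbers of standard tableaux\<close>

text \<open>
  The constant: squaring the hypothesis gives \<open>L = 2 C n / ln n\<close>, and the descent stops near \<open>4 L\<close>.
  Then \<open>e\<^sup>L\<close> costs \<open>2 C n\<close> in the exponent, \<open>m! \<le> n\<^sup>m\<close> costs \<open>(8 C + 1) n\<close>, and the halvings cost \<open>n\<close>;
  a square root of the total gives \<open>5 C + 1\<close>. One more factor \<open>e\<^bsup>- C n\<^esup>\<close> is lost in passing to \<open>S\<close>.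
\<close>

lemma syt_count_lower_bounds:
  fixes C :: real
  assumes T: "T \<in> shapes n" and S: "S \<in> shapes k" and k: "k = n div 2" and n: "3 \<le> n" and C: "C > 0"
    and large: "sqrt (fact n / fact k) * exp (- C * (n / ln n)) \<le> real (skew_count S T)"
  shows "sqrt (fact n) * exp (- (5 * C + 1) * n) \<le> syt_count T"
    and "sqrt (fact k) * exp (- (6 * C + 1) * n) \<le> syt_count S"
proof -
  have ln: "ln n \<ge> 1"
    using n exp_le by (subst ln_ge_iff) auto
  define L where "L = 2 * C * (n / ln n)"
  have "n / ln n \<le> n / 1" using ln n by (intro divide_left_mono) auto
  then have nln: "n / ln n \<le> n" by simp
  then have L: "0 \<le> L" "L \<le> 2 * C * n"
    using C ln mult_left_mono[OF nln, of "2 * C"] by (auto simp: L_def)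
  have "fact n / fact k * exp (- L) = (sqrt (fact n / fact k) * exp (- C * (n / ln n)))\<^sup>2"
    by (simp add: power_mult_distrib exp_double[symmetric] L_def)
  also have "\<dots> \<le> (real (skew_count S T))\<^sup>2"
    using large by (intro power_mono) auto
  also have "\<dots> \<le> sum_squares T k"
    unfolding sum_squares_def using S by (intro member_le_sum) auto
  finally have large': "fact n / fact k * exp (- L) \<le> sum_squares T k" .
  \<comment> \<open>The minimum covers small \<open>n\<close>, for which \<open>4 L\<close> may exceed \<open>k\<close>.\<close>
  define m where "m = min (nat \<lceil>4 * L\<rceil>) k"
  have "4 * L \<le> real i" if "m < i" "i \<le> k" for i
    using that L unfolding m_def by linarith
  then have Qm: "fact n / fact m * exp (- L) / 2 ^ (k - m) \<le> sum_squares T m"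
    using large' L k n by (intro ratio_defect_descent[of n])
      (auto simp: sum_squares_pos[OF T] sum_squares_top[OF T] sum_squares_ratio[OF T] m_def)
  have m: "m \<le> n" "real m \<le> 4 * L + 1" using L k unfolding m_def by linarith+
  have "fact m \<le> real n ^ m"
    using fact_le_power[of m, where ?'a = real] power_mono[of "real m" "real n" m] m by simp
  also have "\<dots> = exp (m * ln n)"
    using n by (simp add: exp_of_nat_mult)
  also have "m * ln n \<le> (4 * L + 1) * ln n"
    using m ln by (intro mult_right_mono) auto
  also have "(4 * L + 1) * ln n = 8 * C * n + ln n"
    using ln by (simp add: L_def algebra_simps)
  also have "\<dots> \<le> (8 * C + 1) * n"
    using ln_le_minus_one[of "real n"] n by (simp add: algebra_simps)
  finally have fact_m: "fact m \<le> exp ((8 * C + 1) * n)" by simp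
  have "(2::real) ^ (k - m) \<le> 2 ^ n" using k by (intro power_increasing) auto
  also have "\<dots> \<le> exp 1 ^ n" using exp_ge_add_one_self[of 1] by (intro power_mono) auto
  also have "\<dots> = exp n" by (simp add: exp_of_nat_mult[symmetric])
  finally have two: "(2::real) ^ (k - m) \<le> exp n" .
  have "(sqrt (fact n) * exp (- (5 * C + 1) * n))\<^sup>2 = fact n * exp (- (10 * C + 2) * n)"
    by (simp add: power_mult_distrib exp_double[symmetric] algebra_simps)
  also have "\<dots> = fact n * (exp (- 2 * C * n) / (exp ((8 * C + 1) * n) * exp n))"
    by (simp add: exp_add[symmetric] exp_diff[symmetric] algebra_simps)
  also have "\<dots> \<le> fact n * (exp (- L) / (fact m * 2 ^ (k - m)))"
    using L fact_m two by (intro mult_left_mono frac_le mult_mono) auto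
  also have "\<dots> \<le> sum_squares T m" using Qm by simp
  also have "\<dots> \<le> (syt_count T)\<^sup>2" by (rule sum_squares_le_syt_count[OF T m(1)])
  finally show lower: "sqrt (fact n) * exp (- (5 * C + 1) * n) \<le> syt_count T"
    by (rule power2_le_imp_le) simp
  have "k \<le> n" using k by simp
  have "sqrt (fact n / fact k) * exp (- C * n) \<le> sqrt (fact n / fact k) * exp (- C * (n / ln n))"
    using mult_left_mono[OF nln, of C] C by (intro mult_left_mono) auto
  with large have large'': "sqrt (fact n / fact k) * exp (- C * n) \<le> real (skew_count S T)"
    by linarith
  have "fact n / fact k * (sqrt (fact k) * exp (- (6 * C + 1) * n))
      = (sqrt (fact n) * exp (- (5 * C + 1) * n)) * (sqrt (fact n / fact k) * exp (- C * n))"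
    by (simp add: real_sqrt_divide exp_add[symmetric] field_simps)
  also have "\<dots> \<le> syt_count T * real (skew_count S T)"
    using lower large'' by (intro mult_mono) auto
  also have "\<dots> \<le> fact n / fact k * syt_count S"
    by (rule syt_count_mult_skew_count_le[OF \<open>k \<le> n\<close> S T])
  finally show "sqrt (fact k) * exp (- (6 * C + 1) * n) \<le> syt_count S"
    by (subst (asm) mult_le_cancel_left_pos) auto
qed

theorem theorem6p4:
  fixes lam mu :: "nat \<Rightarrow> nat list"
  assumes "\<And>n. lam n \<turnstile> n"
    and "\<And>n. mu n \<turnstile> n div 2"
    and "eq_up_to_exp_O (\<lambda>n. real (num_skew_syt (lam n) (mu n)))
           (\<lambda>n. sqrt (fact n / fact (n div 2))) (\<lambda>n. real n / ln (real n))"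
  shows "eq_up_to_exp_O (\<lambda>n. real (num_syt (lam n))) (\<lambda>n. sqrt (fact n)) (\<lambda>n. real n)
       \<and> eq_up_to_exp_O (\<lambda>n. real (num_syt (mu n))) (\<lambda>n. sqrt (fact (n div 2))) (\<lambda>n. real n)"
proof -
  let ?T = "\<lambda>n. young_diagram (lam n)" and ?S = "\<lambda>n. young_diagram (mu n)"
  have T: "?T n \<in> shapes n" and S: "?S n \<in> shapes (n div 2)" for n
    using assms(1,2) by (auto intro: young_diagram_in_shapes)
  obtain C where C: "C > 0" and ev: "\<forall>\<^sub>F n in sequentially.
      sqrt (fact n / fact (n div 2)) * exp (- C * (n / ln n)) \<le> real (skew_count (?S n) (?T n))"
    using assms(3) unfolding eq_up_to_exp_O_def num_skew_syt_eq eventually_conj_iff by blast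
  have upper: "X \<le> Y * exp (K * real n)" if "X \<le> Y" "0 \<le> Y" "0 \<le> K" for X Y K :: real and n
    using that mult_left_mono[of 1 "exp (K * real n)" Y] by simp
  have "\<forall>\<^sub>F n in sequentially.
      sqrt (fact n) * exp (- (5 * C + 1) * n) \<le> syt_count (?T n) \<and>
      sqrt (fact (n div 2)) * exp (- (6 * C + 1) * n) \<le> syt_count (?S n)"
    using ev eventually_ge_at_top[of 3]
    by eventually_elim (intro conjI syt_count_lower_bounds[OF T S refl _ C])
  then show ?thesis
    unfolding eq_up_to_exp_O_def num_syt_eq
    using C syt_count_le_sqrt_fact[OF T] syt_count_le_sqrt_fact[OF S]
    by (intro conjI exI[of _ "5 * C + 1"] exI[of _ "6 * C + 1"])
      (auto intro!: upper elim: eventually_mono)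
qed

end
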